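(* Let $k,p\in\mathbb{N}$, $0<\tau\le 1$, $0<\mu\le 1$, $0\le\tau-\mu<1$, $0\le\delta<1$, $0\le\gamma<1$ and $\tau-\mu+\gamma<1$. Let the functions $f_j(z)=z-\sum_{\nu=k+1}^{\infty}a_{\nu,j}z^\nu$ ($a_{\nu,j}\ge 0$; $j=1,\dots,p$) be in the class $\mathcal{P}_{\tau,\mu}(k,\delta,\gamma)$, and let $q_1,\dots,q_p\ge 0$ satisfy $\sum_{j=1}^{p}q_j=1$. Then the function $$\Theta(z):=\sum_{j=1}^{p}q_jf_j(z)$$ is also in the class $\mathcal{P}_{\tau,\mu}(k,\delta,\gamma)$.
   Context: $\mathbb{U}=\{z\in\mathbb{C}:|z|<1\}$, $\mathbb{N}=\{1,2,3,\dots\}$. For $k\in\mathbb{N}$, $\mathcal{P}(k)$ is the class of functions that are analytic and univalent in $\mathbb{U}$ and of the form $f(z)=z-\sum_{\nu=k+1}^{\infty}a_\nu z^\nu$ with all $a_\nu\ge 0$. Srivastava-Owa fractional derivative: for $0\le\varsigma<1$, $\mathfrak{D}_z^{\varsigma}g(z)=\frac{1}{\Gamma(1-\varsigma)}\frac{d}{dz}\int_0^z g(\zeta)(z-\zeta)^{-\varsigma}\,d\zeta$, where the multiplicity of $(z-\zeta)^{-\varsigma}$ is removed by requiring $\log(z-\zeta)$ to be real when $z-\zeta>0$. Tremblay operator: for $0<\tau\le 1$, $0<\mu\le 1$, $0\le\tau-\mu<1$, $\mathfrak{T}^{\tau,\mu}f(z)=\frac{\Gamma(\mu)}{\Gamma(\tau)}z^{1-\mu}\,\mathfrak{D}_z^{\tau-\mu}\big[z^{\tau-1}f(z)\big]$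 for $z\in\mathbb{U}$. (Powers of $z$ and $\zeta$ are taken with the principal branch and the integral along the segment from $0$ to $z$; the resulting function is understood as extended analytically to all of $\mathbb{U}$, including $z=0$ and the negative real axis.) Class $\mathcal{P}_{\tau,\mu}(k,\delta,\gamma)$ (with $0<\tau\le1$, $0<\mu\le1$, $0\le\tau-\mu<1$, $0\le\delta<1$, $0\le\gamma<1$, $\tau-\mu+\gamma<1$): the set of $f\in\mathcal{P}(k)$ such that for all $z\in\mathbb{U}$ $$\Re\left(\frac{\Gamma(\mu+1)\Gamma(\tau)}{\Gamma(\tau+1)\Gamma(\mu)}z^{-1}\left[(1-\delta)\mathfrak{T}^{\tau,\mu}f(z)+\delta z\big(\mathfrak{T}^{\tau,\mu}f\big)'(z)\right]\right)>\gamma,$$ the value at $z=0$ being understood by removing the singularity. *)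

theory Defs
  imports "HOL-Complex_Analysis.Complex_Analysis"
begin

abbreviation unit_disc :: "complex set" where
  "unit_disc \<equiv> ball 0 1"

(* The Taylor coefficient of order n + k + 1 of f is - a (n + k + 1); the coefficients a 0, ..., a k
   are irrelevant. *)
definition neg_coeff_univalent :: "nat \<Rightarrow> (complex \<Rightarrow> complex) set" where
  "neg_coeff_univalent k = {f. f analytic_on unit_disc \<and> inj_on f unit_disc \<and>
     (\<exists>a :: nat \<Rightarrow> real. (\<forall>\<nu>\<ge>k + 1. a \<nu> \<ge> 0) \<and>
        (\<forall>z\<in>unit_disc.
           (\<lambda>n. of_real (a (n + (k + 1))) * z ^ (n + (k + 1))) sums (z - f z)))}"

(* The Srivastava-Owa fractional derivative of order s, 0 <= s < 1. On the segment from 0 to z the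
   number z - \<zeta> is a nonnegative multiple of z; its power is the principal one. *)
definition frac_deriv :: "real \<Rightarrow> (complex \<Rightarrow> complex) \<Rightarrow> complex \<Rightarrow> complex" where
  "frac_deriv s g z = 1 / of_real (Gamma (1 - s)) *
     deriv (\<lambda>w. contour_integral (linepath 0 w) (\<lambda>\<zeta>. g \<zeta> * (w - \<zeta>) powr (- of_real s))) z"

(* The defining formula of the Tremblay operator. With principal powers it is only meaningful off
   the cut, i.e. for z not a nonpositive real. *)
definition tremblay_formula ::
    "real \<Rightarrow> real \<Rightarrow> (complex \<Rightarrow> complex) \<Rightarrow> complex \<Rightarrow> complex" where
  "tremblay_formula \<tau> \<mu> f z =
     of_real (Gamma \<mu> / Gamma \<tau>) * z powr of_real (1 - \<mu>) *
     frac_deriv (\<tau> - \<mu>) (\<lambda>\<zeta>. \<zeta> powr of_real (\<tau> - 1) * f \<zeta>) z"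

(* The analytic extension of the formula from the slit disc to the whole disc; it is unique on the
   disc by the identity theorem. The value 0 outside the disc is a mere convention. *)
definition tremblay ::
    "real \<Rightarrow> real \<Rightarrow> (complex \<Rightarrow> complex) \<Rightarrow> complex \<Rightarrow> complex" where
  "tremblay \<tau> \<mu> f = (THE h. h analytic_on unit_disc \<and>
     (\<forall>z\<in>unit_disc - \<real>\<^sub>\<le>\<^sub>0. h z = tremblay_formula \<tau> \<mu> f z) \<and>
     (\<forall>z. z \<notin> unit_disc \<longrightarrow> h z = 0))"

definition tremblay_quotient ::
    "real \<Rightarrow> real \<Rightarrow> real \<Rightarrow> (complex \<Rightarrow> complex) \<Rightarrow> complex \<Rightarrow> complex" where
  "tremblay_quotient \<tau> \<mu> \<delta> f z =
     of_real (Gamma (\<mu> + 1) * Gamma \<tau> / (Gamma (\<tau> + 1) * Gamma \<mu>)) * inverse z *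
     (of_real (1 - \<delta>) * tremblay \<tau> \<mu> f z +
      of_real \<delta> * z * deriv (tremblay \<tau> \<mu> f) z)"

(* remove_sings only changes the value at z = 0: elsewhere in the disc the quotient is analytic. *)
definition tremblay_class ::
    "real \<Rightarrow> real \<Rightarrow> nat \<Rightarrow> real \<Rightarrow> real \<Rightarrow> (complex \<Rightarrow> complex) set" where
  "tremblay_class \<tau> \<mu> k \<delta> \<gamma> = {f \<in> neg_coeff_univalent k.
     \<forall>z\<in>unit_disc. Re (remove_sings (tremblay_quotient \<tau> \<mu> \<delta> f) z) > \<gamma>}"

end

theory Submission
  imports Defs
begin

text \<open>
  On the segment from 0 to w the substitution \<zeta> = t w turns the fractional integral into
  w powr \<mu> times a Beta-weighted average of f (t w), so the Tremblay operator acts on power series as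
  a coefficient multiplier. Hence the quotient defining the class, with its singularity removed,
  is linear in f, and the lower bound on its real part is preserved by convex combinations.
  Univalence survives as well: for f(z) = z - (sum of a(n) z^n) with nonnegative a(n) it is equivalent
  to (sum of n a(n) r^(n-1)) < 1 for all 0 <= r < 1, a condition stable under convex combinations.
\<close>

section \<open>Power series on the unit disc and their termwise derivatives\<close>

lemma power_series_has_field_derivative:
  fixes c :: "nat \<Rightarrow> complex"
  assumes "\<And>z. z \<in> unit_disc \<Longrightarrow> (\<lambda>n. c n * z ^ n) sums f z" and "z \<in> unit_disc"
  shows "(f has_field_derivative (\<Sum>n. diffs c n * z ^ n)) (at z)"
    and "(\<lambda>n. diffs c n * z ^ n) sums (\<Sum>n. diffs c n * z ^ n)"
proof -
  have s: "summable (\<lambda>n. c n * z ^ n)" if "norm z < 1" for z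
    using assms(1)[of z] that by (auto simp: sums_iff)
  have z: "norm z < 1" using assms(2) by simp
  have eq: "(\<Sum>n. c n * w ^ n) = f w" if "w \<in> unit_disc" for w
    using assms(1)[OF that] by (simp add: sums_iff)
  show "(f has_field_derivative (\<Sum>n. diffs c n * z ^ n)) (at z)"
    by (rule has_field_derivative_transform_within_open[OF termdiffs_strong'[OF s z] open_ball assms(2) eq])
  show "(\<lambda>n. diffs c n * z ^ n) sums (\<Sum>n. diffs c n * z ^ n)"
    by (rule summable_sums[OF termdiff_converges[OF z s]])
qed

lemma power_series_analytic:
  fixes c :: "nat \<Rightarrow> complex"
  assumes "\<And>z. z \<in> unit_disc \<Longrightarrow> (\<lambda>n. c n * z ^ n) sums f z"
  shows "f analytic_on unit_disc"
  unfolding analytic_on_open[OF open_ball] holomorphic_on_open[OF open_ball]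
  using power_series_has_field_derivative(1)[OF assms] by blast

lemma power_series_euler:
  fixes c :: "nat \<Rightarrow> complex"
  assumes "\<And>z. z \<in> unit_disc \<Longrightarrow> (\<lambda>n. c n * z ^ n) sums f z" and z: "z \<in> unit_disc"
  shows "(\<lambda>n. of_nat n * c n * z ^ n) sums (z * deriv f z)"
proof -
  note D = power_series_has_field_derivative[OF assms]
  have "(\<lambda>n. z * (diffs c n * z ^ n)) sums (z * deriv f z)"
    using sums_mult[OF D(2)] DERIV_imp_deriv[OF D(1)] by simp
  hence "(\<lambda>n. of_nat (Suc n) * c (Suc n) * z ^ Suc n) sums (z * deriv f z)"
    by (simp add: diffs_def algebra_simps)
  \<comment> \<open>The term of index 0 carries the factor 0, so undoing the index shift adds
    nothing.\<close>
  thus ?thesis by (rule sums_Suc_imp[rotated]) simp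
qed

section \<open>The Tremblay operator as a multiplier of Taylor coefficients\<close>

text \<open>Each monomial integrates to a Beta value. Sum and integral may be exchanged by dominated
  convergence: the weight times the sum of the norms of \<open>c n * w ^ n\<close> majorises all
  partial sums.\<close>

lemma beta_integral_power_series:
  fixes c :: "nat \<Rightarrow> complex"
  assumes "0 < \<alpha>" "0 < \<beta>"
    and f: "\<And>z. z \<in> unit_disc \<Longrightarrow> (\<lambda>n. c n * z ^ n) sums f z" and w: "w \<in> unit_disc"
  shows "(\<lambda>n. of_real (Beta (\<alpha> + real n) \<beta>) * c n * w ^ n) sums
    integral {0..1} (\<lambda>t. of_real (t powr (\<alpha> - 1) * (1 - t) powr (\<beta> - 1)) * f (of_real t * w))"
proof -
  define W where "W t = t powr (\<alpha> - 1) * (1 - t) powr (\<beta> - 1)" for t :: real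
  define S where "S N t = of_real (W t) * (\<Sum>n<N. c n * (of_real t * w) ^ n)" for N and t :: real
  define M where "M = (\<Sum>n. norm (c n * w ^ n))"
  have W_nonneg: "W t \<ge> 0" for t by (simp add: W_def)
  have sW: "W t * t ^ n = t powr (\<alpha> + real n - 1) * (1 - t) powr (\<beta> - 1)" if "t \<in> {0..1}" for t n
  \<comment> \<open>At \<open>t = 0\<close> both sides vanish, whatever the exponents, since
    \<open>0 powr x = 0\<close>.\<close>
  proof (cases "t = 0")
    case False
    hence "t powr (\<alpha> + real n - 1) = t powr (\<alpha> - 1) * t ^ n"
      using that by (simp add: powr_realpow powr_add[symmetric] algebra_simps flip: powr_realpow)
    thus ?thesis by (simp add: W_def)
  qed (simp add: W_def)
  have hW: "((\<lambda>t. W t * t ^ n) has_integral Beta (\<alpha> + real n) \<beta>) {0..1}" for n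
    using has_integral_Beta_real[of "\<alpha> + real n" \<beta>] assms(1,2)
    by (subst has_integral_cong[OF sW]) auto
  have hS: "(S N has_integral (\<Sum>n<N. of_real (Beta (\<alpha> + real n) \<beta>) * c n * w ^ n)) {0..1}" for N
  proof -
    have "((\<lambda>t. \<Sum>n<N. of_real (W t * t ^ n) * (c n * w ^ n)) has_integral
        (\<Sum>n<N. of_real (Beta (\<alpha> + real n) \<beta>) * (c n * w ^ n))) {0..1}"
      by (intro has_integral_sum has_integral_mult_left has_integral_of_real hW) auto
    thus ?thesis by (simp add: S_def[abs_def] sum_distrib_left power_mult_distrib mult_ac)
  qed
  \<comment> \<open>Convergence at a point of larger modulus gives absolute convergence at
    \<open>w\<close>, so \<open>M\<close> is a genuine bound.\<close>
  obtain r where r: "norm w < r" "r < 1" using w dense[of "norm w" 1] by auto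
  have "summable (\<lambda>n. norm (c n * w ^ n))"
  proof (rule powser_insidea)
    have *: "norm (of_real r :: complex) = r" using r(1) norm_ge_zero[of w] by (simp del: norm_ge_zero)
    hence "of_real r \<in> unit_disc" using r by simp
    thus "summable (\<lambda>n. c n * of_real r ^ n)" using f by (blast intro: sums_summable)
    show "norm w < norm (of_real r :: complex)" using r(1) * by simp
  qed
  hence M: "(\<Sum>n<N. norm (c n * w ^ n)) \<le> M" for N
    unfolding M_def by (intro sum_le_suminf) auto
  have bd: "norm (S N t) \<le> M * W t" if "t \<in> {0..1}" for N t
  proof -
    have "norm (\<Sum>n<N. c n * (of_real t * w) ^ n) \<le> (\<Sum>n<N. norm (c n * w ^ n))"
      using that by (intro sum_norm_le)
        (auto simp: norm_mult norm_power power_mult_distrib mult_left_le_one_le power_le_one intro!: mult_left_mono)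
    also note M[of N]
    finally have "W t * norm (\<Sum>n<N. c n * (of_real t * w) ^ n) \<le> W t * M"
      using W_nonneg[of t] by (intro mult_left_mono)
    thus ?thesis using W_nonneg[of t] by (simp add: S_def norm_mult mult.commute)
  qed
  have lim: "(\<lambda>N. S N t) \<longlonglongrightarrow> of_real (W t) * f (of_real t * w)" if "t \<in> {0..1}" for t
  proof -
    have "norm (of_real t * w) \<le> norm w" using that by (simp add: norm_mult mult_left_le_one_le)
    with w have "of_real t * w \<in> unit_disc" by simp
    from f[OF this] show ?thesis unfolding S_def sums_def by (intro tendsto_mult) auto
  qed
  have "(\<lambda>N. integral {0..1} (S N)) \<longlonglongrightarrow> integral {0..1} (\<lambda>t. of_real (W t) * f (of_real t * w))"
  proof (rule dominated_convergence(2))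
    show "(\<lambda>t. M * W t) integrable_on {0..1}"
      using has_integral_mult_right[OF hW[of 0], of M] by (auto simp: integrable_on_def)
  qed (use hS bd lim in \<open>auto intro: has_integral_integrable\<close>)
  thus ?thesis unfolding sums_def W_def integral_unique[OF hS] .
qed

text \<open>With \<zeta> = t w, the factors t and 1 - t are nonnegative reals, so the principal
  powers of the products split without a branch correction. The exponents \<tau> - 1, - s and the 1
  coming from d\<zeta> = w dt add up to \<tau> - s. The form \<open>(1 - s) - 1\<close> matches the
  Beta weight with second parameter \<open>1 - s\<close>.\<close>

lemma contour_integral_frac_deriv:
  assumes "w \<noteq> 0"
  shows "contour_integral (linepath 0 w)
      (\<lambda>\<zeta>. \<zeta> powr of_real (\<tau> - 1) * f \<zeta> * (w - \<zeta>) powr (- of_real s)) =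
    w powr of_real (\<tau> - s) *
    integral {0..1} (\<lambda>t. of_real (t powr (\<tau> - 1) * (1 - t) powr ((1 - s) - 1)) * f (of_real t * w))"
proof -
  have "(of_real t * w) powr of_real (\<tau> - 1) * f (of_real t * w) * (w - of_real t * w) powr (- of_real s) * w =
    w powr of_real (\<tau> - s) * (of_real (t powr (\<tau> - 1) * (1 - t) powr ((1 - s) - 1)) * f (of_real t * w))"
    if "t \<in> {0..1}" for t
  proof -
    have "w - of_real t * w = of_real (1 - t) * w" by (simp add: algebra_simps)
    hence 1: "(w - of_real t * w) powr (- of_real s) = of_real ((1 - t) powr (- s)) * w powr (- of_real s)"
      using that powr_of_real[of "1 - t" "- s"] by (simp only: powr_times_real_left) (auto simp: powr_times_real_left)
    have 2: "(of_real t * w) powr of_real (\<tau> - 1) = of_real (t powr (\<tau> - 1)) * w powr of_real (\<tau> - 1)"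
      using that powr_of_real[of t "\<tau> - 1"] by (auto simp: powr_times_real_left)
    have "w powr of_real (\<tau> - s) = w powr (of_real (\<tau> - 1) + (- of_real s) + 1)" by simp
    also have "\<dots> = w powr of_real (\<tau> - 1) * w powr (- of_real s) * w"
      using assms by (simp only: powr_add) simp
    finally show ?thesis unfolding 1 2 by simp
  qed
  thus ?thesis
    unfolding contour_integral_integral
    by (subst Henstock_Kurzweil_Integration.integral_mult_right[symmetric], intro integral_cong)
       (simp add: linepath_def scaleR_conv_of_real)
qed

text \<open>For positive \<tau>, \<mu> with \<tau> - \<mu> < 1 this is Gamma(\<mu>) Gamma(\<tau> +
  n) / (Gamma(\<tau>) Gamma(\<mu> + n)). The Beta value comes from the termwise integral, the factor
  \<mu> + n from differentiating the power of exponent \<mu> + n.\<close>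

definition tremblay_mult :: "real \<Rightarrow> real \<Rightarrow> nat \<Rightarrow> complex" where
  "tremblay_mult \<tau> \<mu> n = of_real (Gamma \<mu> / (Gamma \<tau> * Gamma (1 - (\<tau> - \<mu>))) *
     (\<mu> + real n) * Beta (\<tau> + real n) (1 - (\<tau> - \<mu>)))"

text \<open>The fractional integral is w^\<mu> F(w) with F a power series. Differentiating and
  multiplying by w^(1 - \<mu>) leaves \<mu> F + w F', which contains no fractional power, so it is
  the analytic extension to the whole disc.\<close>

lemma tremblay_sums:
  fixes c :: "nat \<Rightarrow> complex"
  assumes "0 < \<tau>" "\<tau> - \<mu> < 1"
    and f: "\<And>z. z \<in> unit_disc \<Longrightarrow> (\<lambda>n. c n * z ^ n) sums f z" and z: "z \<in> unit_disc"
  shows "(\<lambda>n. tremblay_mult \<tau> \<mu> n * c n * z ^ n) sums tremblay \<tau> \<mu> f z"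
proof -
  define s where "s = \<tau> - \<mu>"
  define K where "K = (of_real (Gamma \<mu> / (Gamma \<tau> * Gamma (1 - s))) :: complex)"
  define F where "F w = integral {0..1}
    (\<lambda>t. of_real (t powr (\<tau> - 1) * (1 - t) powr ((1 - s) - 1)) * f (of_real t * w))" for w
  \<comment> \<open>The value 0 outside the disc follows the convention in \<open>tremblay\<close>;
    without it the description would not single out \<open>h\<close>.\<close>
  define h where "h w = (if w \<in> unit_disc then K * (of_real \<mu> * F w + w * deriv F w) else 0)" for w
  have F: "(\<lambda>n. (of_real (Beta (\<tau> + real n) (1 - s)) * c n) * w ^ n) sums F w" if "w \<in> unit_disc" for w
    unfolding F_def using assms that by (intro beta_integral_power_series) (auto simp: s_def)
  have h: "(\<lambda>n. (tremblay_mult \<tau> \<mu> n * c n) * w ^ n) sums h w" if "w \<in> unit_disc" for w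
  proof -
    have "(\<lambda>n. K * (of_real \<mu> * ((of_real (Beta (\<tau> + real n) (1 - s)) * c n) * w ^ n) +
        of_nat n * (of_real (Beta (\<tau> + real n) (1 - s)) * c n) * w ^ n)) sums h w"
      using sums_mult[OF sums_add[OF sums_mult[OF F[OF that]] power_series_euler[OF F that]]] that
      by (simp add: h_def)
    moreover have "K * (of_real \<mu> * ((of_real (Beta (\<tau> + real n) (1 - s)) * c n) * w ^ n) +
        of_nat n * (of_real (Beta (\<tau> + real n) (1 - s)) * c n) * w ^ n) =
        tremblay_mult \<tau> \<mu> n * c n * w ^ n" for n
    proof -
      have "tremblay_mult \<tau> \<mu> n = K * (of_real \<mu> + of_nat n) * of_real (Beta (\<tau> + real n) (1 - s))"
        by (simp add: tremblay_mult_def K_def s_def)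
      thus ?thesis by (simp add: algebra_simps)
    qed
    ultimately show ?thesis by simp
  qed
  have h_analytic: "h analytic_on unit_disc" by (rule power_series_analytic[OF h])
  have h_eq: "h w = tremblay_formula \<tau> \<mu> f w" if w: "w \<in> unit_disc - \<real>\<^sub>\<le>\<^sub>0" for w
  proof -
    have [simp]: "w \<noteq> 0" "w \<notin> \<real>\<^sub>\<le>\<^sub>0" "w \<in> unit_disc" using w by auto
    have F': "(F has_field_derivative deriv F w) (at w)"
      using power_series_has_field_derivative(1)[OF F \<open>w \<in> unit_disc\<close>] by (simp add: DERIV_imp_deriv)
    have "eventually (\<lambda>v. v \<in> - {0}) (nhds w)" by (intro eventually_nhds_in_open) auto
    hence "eventually (\<lambda>v. contour_integral (linepath 0 v)
        (\<lambda>\<zeta>. \<zeta> powr of_real (\<tau> - 1) * f \<zeta> * (v - \<zeta>) powr (- of_real s)) =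
        v powr of_real \<mu> * F v) (nhds w)"
      by eventually_elim (subst contour_integral_frac_deriv, auto simp: F_def s_def)
    hence "deriv (\<lambda>v. contour_integral (linepath 0 v)
        (\<lambda>\<zeta>. \<zeta> powr of_real (\<tau> - 1) * f \<zeta> * (v - \<zeta>) powr (- of_real s))) w =
        deriv (\<lambda>v. v powr of_real \<mu> * F v) w"
      by (rule deriv_cong_ev) simp
    also have "\<dots> = of_real \<mu> * w powr (of_real \<mu> - 1) * F w + deriv F w * w powr of_real \<mu>"
      by (rule DERIV_imp_deriv, rule DERIV_mult[OF has_field_derivative_powr F']) simp
    finally have D: "frac_deriv s (\<lambda>\<zeta>. \<zeta> powr of_real (\<tau> - 1) * f \<zeta>) w = 1 / of_real (Gamma (1 - s)) *
        (of_real \<mu> * w powr (of_real \<mu> - 1) * F w + deriv F w * w powr of_real \<mu>)"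
      by (simp add: frac_deriv_def)
    \<comment> \<open>Here the outer power cancels both remaining fractional powers, and with them
      the branch cut.\<close>
    have P: "w powr of_real (1 - \<mu>) * w powr (of_real \<mu> - 1) = 1"
      "w powr of_real (1 - \<mu>) * w powr of_real \<mu> = w"
      by (simp_all add: powr_add[symmetric])
    have "tremblay_formula \<tau> \<mu> f w = K * (of_real \<mu> * (w powr of_real (1 - \<mu>) * w powr (of_real \<mu> - 1)) * F w +
        (w powr of_real (1 - \<mu>) * w powr of_real \<mu>) * deriv F w)"
      unfolding tremblay_formula_def s_def[symmetric] D K_def by (simp add: algebra_simps)
    thus ?thesis unfolding P h_def if_P[OF \<open>w \<in> unit_disc\<close>] by simp
  qed
  have "tremblay \<tau> \<mu> f = h"
    unfolding tremblay_def
  proof (rule the_equality)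
    show "h analytic_on unit_disc \<and> (\<forall>z\<in>unit_disc - \<real>\<^sub>\<le>\<^sub>0. h z = tremblay_formula \<tau> \<mu> f z) \<and>
        (\<forall>z. z \<notin> unit_disc \<longrightarrow> h z = 0)"
      using h_analytic h_eq by (auto simp: h_def)
  next
    fix g assume g: "g analytic_on unit_disc \<and> (\<forall>z\<in>unit_disc - \<real>\<^sub>\<le>\<^sub>0. g z = tremblay_formula \<tau> \<mu> f z) \<and>
        (\<forall>z. z \<notin> unit_disc \<longrightarrow> g z = 0)"
    \<comment> \<open>The identity theorem needs the slit disc to be nonempty.\<close>
    have "1 / 2 \<in> unit_disc - (\<real>\<^sub>\<le>\<^sub>0 :: complex set)" by (simp add: complex_nonpos_Reals_iff norm_divide)
    hence ne: "unit_disc - \<real>\<^sub>\<le>\<^sub>0 \<noteq> {}" by blast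
    have "g w = h w" if "w \<in> unit_disc" for w
      by (rule analytic_continuation_open[of "unit_disc - \<real>\<^sub>\<le>\<^sub>0" unit_disc g h])
        (use g h_eq h_analytic ne that in \<open>auto simp: analytic_imp_holomorphic\<close>)
    thus "g = h" using g by (auto simp: h_def)
  qed
  thus ?thesis using h[OF z] by simp
qed

text \<open>Since \<open>c 0 = 0\<close>, the factor \<open>inverse z\<close> only lowers every
  exponent by one, while z d/dz supplies the factor \<open>Suc n\<close>. The resulting series also
  converges at 0 and is continuous there, so its value is the one chosen by
  \<open>remove_sings\<close>.\<close>

lemma remove_sings_tremblay_quotient_sums:
  fixes c :: "nat \<Rightarrow> complex"
  assumes "0 < \<tau>" "\<tau> - \<mu> < 1"
    and f: "\<And>z. z \<in> unit_disc \<Longrightarrow> (\<lambda>n. c n * z ^ n) sums f z" and c0: "c 0 = 0"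
    and z: "z \<in> unit_disc"
  shows "(\<lambda>n. of_real (Gamma (\<mu> + 1) * Gamma \<tau> / (Gamma (\<tau> + 1) * Gamma \<mu>)) *
      (of_real (1 - \<delta>) + of_real \<delta> * of_nat (Suc n)) * tremblay_mult \<tau> \<mu> (Suc n) * c (Suc n) * z ^ n)
    sums remove_sings (tremblay_quotient \<tau> \<mu> \<delta> f) z"
proof -
  define C where "C = (of_real (Gamma (\<mu> + 1) * Gamma \<tau> / (Gamma (\<tau> + 1) * Gamma \<mu>)) :: complex)"
  define b where "b n = tremblay_mult \<tau> \<mu> n * c n" for n
  define d where "d n = C * (of_real (1 - \<delta>) + of_real \<delta> * of_nat (Suc n)) * b (Suc n)" for n
  define G where "G w = (\<Sum>n. d n * w ^ n)" for w
  have T: "(\<lambda>n. b n * w ^ n) sums tremblay \<tau> \<mu> f w" if "w \<in> unit_disc" for w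
    unfolding b_def using assms that by (intro tremblay_sums)
  have Q: "(\<lambda>n. d n * w ^ n) sums tremblay_quotient \<tau> \<mu> \<delta> f w" if w: "w \<in> unit_disc" "w \<noteq> 0" for w
  proof -
    let ?t = "\<lambda>n. of_real (1 - \<delta>) * (b n * w ^ n) + of_real \<delta> * (of_nat n * b n * w ^ n)"
    have "?t sums
        (of_real (1 - \<delta>) * tremblay \<tau> \<mu> f w + of_real \<delta> * (w * deriv (tremblay \<tau> \<mu> f) w))"
      by (intro sums_add sums_mult T power_series_euler w(1))
    hence "(\<lambda>n. ?t (Suc n)) sums
        (of_real (1 - \<delta>) * tremblay \<tau> \<mu> f w + of_real \<delta> * (w * deriv (tremblay \<tau> \<mu> f) w))"
      by (subst sums_Suc_iff) (simp add: b_def c0)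
    hence "(\<lambda>n. C * inverse w * ?t (Suc n)) sums
        tremblay_quotient \<tau> \<mu> \<delta> f w"
      using sums_mult[of _ _ "C * inverse w"] by (simp add: tremblay_quotient_def C_def mult.assoc)
    moreover have "C * inverse w * ?t (Suc n) =
        d n * w ^ n" for n
      using w(2) by (simp add: d_def field_simps del: of_nat_Suc)
    ultimately show ?thesis by simp
  qed
  have G: "(\<lambda>n. d n * w ^ n) sums G w" if "w \<in> unit_disc" for w
  proof (cases "w = 0")
    case True
    thus ?thesis unfolding G_def by (intro summable_sums) (simp add: summable_0_powser)
  next
    case False
    thus ?thesis unfolding G_def using Q[OF that] by (auto intro: summable_sums sums_summable)
  qed
  have "continuous_on unit_disc G"
    using power_series_analytic[OF G] by (intro holomorphic_on_imp_continuous_on analytic_imp_holomorphic)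
  hence "isCont G z" using z by (simp add: continuous_on_eq_continuous_at)
  hence "G \<midarrow>z\<rightarrow> G z" by (simp add: isCont_def)
  \<comment> \<open>Only a punctured neighbourhood of \<open>z\<close> matters, and 0 can be avoided
    there whether or not \<open>z = 0\<close>.\<close>
  moreover have "eventually (\<lambda>w. G w = tremblay_quotient \<tau> \<mu> \<delta> f w) (at z)"
  proof -
    have "eventually (\<lambda>w. w \<in> unit_disc) (at z)" "eventually (\<lambda>w. w \<noteq> 0) (at z)"
      using eventually_at_in_open'[OF open_ball z] by (auto simp: eventually_neq_at_within)
    thus ?thesis by eventually_elim (use Q G sums_unique2 in blast)
  qed
  ultimately have "tremblay_quotient \<tau> \<mu> \<delta> f \<midarrow>z\<rightarrow> G z" by (simp cong: tendsto_cong)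
  hence "remove_sings (tremblay_quotient \<tau> \<mu> \<delta> f) z = G z" by (rule remove_sings_eqI)
  thus ?thesis using G[OF z] by (simp add: d_def C_def b_def mult.assoc)
qed

section \<open>Univalence of functions with nonnegative subtracted coefficients\<close>

text \<open>Setting the unspecified coefficients up to index \<open>k\<close> to 0 yields a series
  over all indices, nonnegative throughout, to which the power series lemmas apply.\<close>

lemma neg_coeff_univalentE:
  assumes "f \<in> neg_coeff_univalent k"
  obtains a :: "nat \<Rightarrow> real" where "\<And>n. a n \<ge> 0" "\<And>n. n \<le> k \<Longrightarrow> a n = 0"
    "\<And>z. z \<in> unit_disc \<Longrightarrow> (\<lambda>n. of_real (a n) * z ^ n) sums (z - f z)"
proof -
  from assms obtain b :: "nat \<Rightarrow> real" where b: "\<And>n. n \<ge> k + 1 \<Longrightarrow> b n \<ge> 0"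
    "\<And>z. z \<in> unit_disc \<Longrightarrow> (\<lambda>n. of_real (b (n + (k + 1))) * z ^ (n + (k + 1))) sums (z - f z)"
    unfolding neg_coeff_univalent_def by blast
  define a where "a n = (if n \<le> k then 0 else b n)" for n
  show thesis
  proof (rule that)
    show "(\<lambda>n. of_real (a n) * z ^ n) sums (z - f z)" if "z \<in> unit_disc" for z
    proof (subst sums_zero_iff_shift[of "k + 1", symmetric])
      show "(\<lambda>n. of_real (a (n + (k + 1))) * z ^ (n + (k + 1))) sums (z - f z)"
        using b(2)[OF that] by (simp add: a_def)
    qed (simp add: a_def)
  qed (use b(1) in \<open>auto simp: a_def\<close>)
qed

lemma summable_diffs_of_real:
  fixes a :: "nat \<Rightarrow> real"
  assumes "\<And>z. z \<in> unit_disc \<Longrightarrow> (\<lambda>n. of_real (a n) * z ^ n) sums g z" and "\<bar>r\<bar> < 1"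
  shows "summable (\<lambda>n. diffs a n * r ^ n)"
proof (rule termdiff_converges[where K = 1])
  show "summable (\<lambda>n. a n * x ^ n)" if "norm x < 1" for x :: real
  proof -
    have "(\<lambda>n. of_real (a n * x ^ n) :: complex) sums g (of_real x)"
      using assms(1)[of "of_real x"] that by simp
    thus ?thesis by (intro summable_of_real_iff[THEN iffD1, OF sums_summable])
  qed
qed (use assms(2) in simp)

text \<open>
  On the real segment the derivative of f is real, equals 1 at the origin and never vanishes,
  so it stays positive.
\<close>

lemma suminf_diffs_less_1_of_inj_on:
  fixes a :: "nat \<Rightarrow> real"
  assumes f: "\<And>z. z \<in> unit_disc \<Longrightarrow> (\<lambda>n. of_real (a n) * z ^ n) sums (z - f z)"
    and inj: "inj_on f unit_disc" and "a 1 = 0" and r: "0 \<le> r" "r < 1"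
  shows "(\<Sum>n. diffs a n * r ^ n) < 1"
proof (rule ccontr)
  define A where "A x = (\<Sum>n. diffs a n * x ^ n)" for x :: real
  assume "\<not> (\<Sum>n. diffs a n * r ^ n) < 1"
  hence Ar: "1 \<le> A r" by (simp add: A_def)
  have sA: "summable (\<lambda>n. diffs a n * x ^ n)" if "norm x < 1" for x
    using summable_diffs_of_real[OF f] that by simp
  have "isCont A x" if "0 \<le> x" "x \<le> r" for x
    unfolding A_def by (rule DERIV_isCont[OF termdiffs_strong'[OF sA]]) (use that r in auto)
  hence "continuous_on {0..r} A" by (intro continuous_at_imp_continuous_on) auto
  moreover have "A 0 \<le> 1" using assms(3) by (simp add: A_def diffs_def)
  \<comment> \<open>\<open>A 0\<close> is \<open>a 1 = 0\<close> and \<open>A r\<close> is at least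
    1; where \<open>A\<close> takes the value 1, the derivative of \<open>f\<close>, which is 1 -
    \<open>A\<close>, vanishes.\<close>
  ultimately obtain x where x: "0 \<le> x" "x \<le> r" "A x = 1" using IVT'[of A 0 1 r] Ar r by auto
  have x_disc: "of_real x \<in> unit_disc" using x r by simp
  have "((\<lambda>z. z - f z) has_field_derivative (\<Sum>n. diffs (\<lambda>n. of_real (a n)) n * of_real x ^ n))
      (at (of_real x))"
    by (rule power_series_has_field_derivative(1)[OF f x_disc])
  moreover have "(\<Sum>n. diffs (\<lambda>n. of_real (a n)) n * of_real x ^ n) = (of_real (A x) :: complex)"
    unfolding A_def using suminf_of_real[OF sA, of x, where 'a = complex] x r by (simp add: diffs_def)
  ultimately have g: "((\<lambda>z. z - f z) has_field_derivative 1) (at (of_real x))" using x by simp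
  have D: "(f has_field_derivative 0) (at (of_real x))"
    using DERIV_diff[OF DERIV_ident g] by simp
  have "(\<lambda>z. z - f z) analytic_on unit_disc" by (rule power_series_analytic[OF f])
  hence "f holomorphic_on unit_disc"
    using holomorphic_on_diff[OF holomorphic_on_ident analytic_imp_holomorphic] by fastforce
  hence "deriv f (of_real x) \<noteq> 0"
    using holomorphic_injective_imp_regular[OF _ open_ball inj x_disc] by simp
  thus False using DERIV_imp_deriv[OF D] by simp
qed

text \<open>Nonnegative coefficients bound the derivative of z - f(z) on the closed disc of radius r
  by its value B < 1 at the point r. So z - f(z) is a strict contraction there, whereas f(z) = f(w)
  would make it preserve the distance of z and w.\<close>

lemma inj_on_of_suminf_diffs_less_1:
  fixes a :: "nat \<Rightarrow> real"
  assumes f: "\<And>z. z \<in> unit_disc \<Longrightarrow> (\<lambda>n. of_real (a n) * z ^ n) sums (z - f z)"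
    and a: "\<And>n. a n \<ge> 0" and less: "\<And>r. 0 \<le> r \<Longrightarrow> r < 1 \<Longrightarrow> (\<Sum>n. diffs a n * r ^ n) < 1"
  shows "inj_on f unit_disc"
proof (rule inj_onI, rule ccontr)
  fix z w assume zw: "z \<in> unit_disc" "w \<in> unit_disc" "f z = f w" "z \<noteq> w"
  \<comment> \<open>The closed disc of radius \<open>r\<close> is convex, contains both points and
    lies in the unit disc.\<close>
  define r where "r = max (norm z) (norm w)"
  have r: "0 \<le> r" "r < 1" using zw by (auto simp: r_def le_max_iff_disj)
  define B where "B = (\<Sum>n. diffs a n * r ^ n)"
  have sB: "summable (\<lambda>n. diffs a n * r ^ n)" using summable_diffs_of_real[OF f] r by simp
  have "norm ((z - f z) - (w - f w)) \<le> B * norm (z - w)"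
  proof (rule field_differentiable_bound[of "cball 0 r"])
    fix x :: complex assume "x \<in> cball 0 r"
    hence x: "norm x \<le> r" "x \<in> unit_disc" using r by auto
    show "((\<lambda>z. z - f z) has_field_derivative (\<Sum>n. diffs (\<lambda>n. of_real (a n)) n * x ^ n)) (at x within cball 0 r)"
      by (rule has_field_derivative_at_within[OF power_series_has_field_derivative(1)[OF f x(2)]])
    have "norm (diffs (\<lambda>n. of_real (a n)) n * x ^ n) \<le> diffs a n * r ^ n" for n
      using a x(1) by (auto simp: diffs_def norm_mult norm_power abs_mult simp del: of_nat_Suc
          intro!: mult_mono power_mono)
    thus "norm (\<Sum>n. diffs (\<lambda>n. of_real (a n)) n * x ^ n) \<le> B"
      unfolding B_def by (rule norm_suminf_le[OF _ sB])
  qed (auto simp: r_def)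
  also have "\<dots> < norm (z - w)" using less[OF r] zw by (simp add: B_def)
  finally show False using zw by simp
qed

text \<open>Weights summing to 1 cannot all vanish, and one positive weight is enough to keep the
  inequality strict.\<close>

lemma convex_sum_bound_less:
  fixes x q :: "'a \<Rightarrow> real"
  assumes q: "\<And>j. j \<in> I \<Longrightarrow> q j \<ge> 0" and q1: "(\<Sum>j\<in>I. q j) = 1"
    and x: "\<And>j. j \<in> I \<Longrightarrow> x j < b"
  shows "(\<Sum>j\<in>I. q j * x j) < b"
proof -
  \<comment> \<open>A sum over an infinite set is 0 by convention, contradicting
    \<open>q1\<close>.\<close>
  have "finite I" using q1 by (metis sum.infinite zero_neq_one)
  obtain i where i: "i \<in> I" "q i \<noteq> 0" using q1 by (metis sum.neutral zero_neq_one)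
  have "(\<Sum>j\<in>I. q j * x j) < (\<Sum>j\<in>I. q j * b)"
  proof (rule sum_strict_mono_ex1[OF \<open>finite I\<close>])
    show "\<forall>j\<in>I. q j * x j \<le> q j * b" using q x by (simp add: mult_left_mono less_imp_le)
    show "\<exists>j\<in>I. q j * x j < q j * b" using i q[OF i(1)] x[OF i(1)] by (auto intro!: bexI[of _ i])
  qed
  also have "\<dots> = b" using q1 by (simp flip: sum_distrib_right)
  finally show ?thesis .
qed

text \<open>Injectivity itself does not pass to sums, but the equivalent bound on the derivative
  series is linear in the coefficients. Each \<open>f j\<close> yields the bound, the bounds are
  averaged, and the average gives injectivity back.\<close>

lemma neg_coeff_univalent_convex_combination:
  assumes "k \<ge> 1"
    and f: "\<And>j. j \<in> I \<Longrightarrow> f j \<in> neg_coeff_univalent k"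
    and q: "\<And>j. j \<in> I \<Longrightarrow> q j \<ge> 0" and q1: "(\<Sum>j\<in>I. q j) = 1"
  shows "(\<lambda>z. \<Sum>j\<in>I. of_real (q j) * f j z) \<in> neg_coeff_univalent k"
proof -
  have "\<exists>a :: nat \<Rightarrow> real. (\<forall>n. a n \<ge> 0) \<and> (\<forall>n\<le>k. a n = 0) \<and>
      (\<forall>z\<in>unit_disc. (\<lambda>n. of_real (a n) * z ^ n) sums (z - f j z))" if "j \<in> I" for j
    using neg_coeff_univalentE[OF f[OF that]] by metis
  then obtain a :: "'a \<Rightarrow> nat \<Rightarrow> real" where a: "\<And>j n. j \<in> I \<Longrightarrow> a j n \<ge> 0"
    "\<And>j n. j \<in> I \<Longrightarrow> n \<le> k \<Longrightarrow> a j n = 0"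
    "\<And>j z. j \<in> I \<Longrightarrow> z \<in> unit_disc \<Longrightarrow> (\<lambda>n. of_real (a j n) * z ^ n) sums (z - f j z)"
    by metis
  define F where "F z = (\<Sum>j\<in>I. of_real (q j) * f j z)" for z
  define A where "A n = (\<Sum>j\<in>I. q j * a j n)" for n
  have A_nonneg: "A n \<ge> 0" for n unfolding A_def using a(1) q by (intro sum_nonneg) auto
  have A_0: "A n = 0" if "n \<le> k" for n unfolding A_def using a(2) that by simp
  have A: "(\<lambda>n. of_real (A n) * z ^ n) sums (z - F z)" if "z \<in> unit_disc" for z
  proof -
    have "(\<lambda>n. \<Sum>j\<in>I. of_real (q j) * (of_real (a j n) * z ^ n)) sums (\<Sum>j\<in>I. of_real (q j) * (z - f j z))"
      using that by (intro sums_sum sums_mult a(3))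
    \<comment> \<open>The weights sum to 1, so the leading term \<open>z\<close> is reproduced
      exactly.\<close>
    moreover have "(\<Sum>j\<in>I. of_real (q j) * (z - f j z)) = of_real (\<Sum>j\<in>I. q j) * z - F z"
      by (simp add: F_def right_diff_distrib sum_subtractf sum_distrib_right)
    ultimately show ?thesis by (simp add: q1 A_def sum_distrib_right mult.assoc)
  qed
  have "(\<Sum>n. diffs A n * r ^ n) < 1" if r: "0 \<le> r" "r < 1" for r
  proof -
    have s: "summable (\<lambda>n. diffs (a j) n * r ^ n)" if "j \<in> I" for j
      using summable_diffs_of_real[OF a(3)[OF that]] r by simp
    have "(\<lambda>n. \<Sum>j\<in>I. q j * (diffs (a j) n * r ^ n)) sums (\<Sum>j\<in>I. q j * (\<Sum>n. diffs (a j) n * r ^ n))"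
      by (intro sums_sum sums_mult summable_sums s)
    hence "(\<Sum>n. diffs A n * r ^ n) = (\<Sum>j\<in>I. q j * (\<Sum>n. diffs (a j) n * r ^ n))"
      by (simp add: sums_iff diffs_def A_def sum_distrib_left sum_distrib_right mult_ac del: of_nat_Suc)
    also have "\<dots> < 1"
    proof (rule convex_sum_bound_less)
      show "(\<Sum>n. diffs (a j) n * r ^ n) < 1" if "j \<in> I" for j
      proof (rule suminf_diffs_less_1_of_inj_on[OF a(3)[OF that] _ _ r])
        show "inj_on (f j) unit_disc" using f[OF that] by (simp add: neg_coeff_univalent_def)
        show "a j 1 = 0" by (rule a(2)[OF that assms(1)])
      qed
    qed (use q q1 in auto)
    finally show ?thesis .
  qed
  from inj_on_of_suminf_diffs_less_1[OF A A_nonneg this]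
  have "inj_on F unit_disc" .
  moreover have "F analytic_on unit_disc"
    unfolding F_def using f by (intro analytic_intros) (auto simp: neg_coeff_univalent_def)
  moreover have "(\<lambda>n. of_real (A (n + (k + 1))) * z ^ (n + (k + 1))) sums (z - F z)" if "z \<in> unit_disc" for z
    using A[OF that] A_0 by (subst sums_zero_iff_shift) auto
  ultimately have "F \<in> neg_coeff_univalent k"
    unfolding neg_coeff_univalent_def using A_nonneg by blast
  thus ?thesis by (simp add: F_def[abs_def])
qed

section \<open>Linearity of the quotient and closure under convex combinations\<close>

text \<open>Both sides are sums of the same series, because the multiplier \<open>L n\<close> does
  not depend on the function. Comparing coefficients avoids arguing about the definite description
  in \<open>tremblay\<close> and the limit in \<open>remove_sings\<close>.\<close>

lemma remove_sings_tremblay_quotient_sum: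
  assumes "0 < \<tau>" "\<tau> - \<mu> < 1"
    and f: "\<And>j. j \<in> I \<Longrightarrow> f j analytic_on unit_disc" "\<And>j. j \<in> I \<Longrightarrow> f j 0 = 0"
    and z: "z \<in> unit_disc"
  shows "remove_sings (tremblay_quotient \<tau> \<mu> \<delta> (\<lambda>z. \<Sum>j\<in>I. q j * f j z)) z =
    (\<Sum>j\<in>I. q j * remove_sings (tremblay_quotient \<tau> \<mu> \<delta> (f j)) z)"
proof -
  define c where "c j n = (deriv ^^ n) (f j) 0 / fact n" for j n
  define L where "L n = of_real (Gamma (\<mu> + 1) * Gamma \<tau> / (Gamma (\<tau> + 1) * Gamma \<mu>)) *
      (of_real (1 - \<delta>) + of_real \<delta> * of_nat (Suc n)) * tremblay_mult \<tau> \<mu> (Suc n)" for n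
  have c: "(\<lambda>n. c j n * w ^ n) sums f j w" if "j \<in> I" "w \<in> unit_disc" for j w
    using holomorphic_power_series[of "f j" 0 1 w] f(1)[OF that(1)] that(2)
    by (simp add: c_def analytic_imp_holomorphic)
  have sum_c: "(\<lambda>n. (\<Sum>j\<in>I. q j * c j n) * w ^ n) sums (\<Sum>j\<in>I. q j * f j w)" if "w \<in> unit_disc" for w
    using sums_sum[of I "\<lambda>j n. q j * (c j n * w ^ n)" "\<lambda>j. q j * f j w"] c that
    by (simp add: sums_mult sum_distrib_right mult.assoc)
  have c_0: "c j 0 = 0" if "j \<in> I" for j using f(2)[OF that] by (simp add: c_def)
  have "(\<lambda>n. L n * c j (Suc n) * z ^ n) sums remove_sings (tremblay_quotient \<tau> \<mu> \<delta> (f j)) z"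
    if "j \<in> I" for j
    unfolding L_def by (rule remove_sings_tremblay_quotient_sums[OF assms(1,2) c[OF that] c_0[OF that] z])
  hence "(\<lambda>n. \<Sum>j\<in>I. q j * (L n * c j (Suc n) * z ^ n)) sums
      (\<Sum>j\<in>I. q j * remove_sings (tremblay_quotient \<tau> \<mu> \<delta> (f j)) z)"
    by (intro sums_sum sums_mult)
  moreover have "(\<lambda>n. L n * (\<Sum>j\<in>I. q j * c j (Suc n)) * z ^ n) sums
      remove_sings (tremblay_quotient \<tau> \<mu> \<delta> (\<lambda>z. \<Sum>j\<in>I. q j * f j z)) z"
    unfolding L_def
    by (rule remove_sings_tremblay_quotient_sums[OF assms(1,2) sum_c _ z]) (auto intro!: sum.neutral simp: c_0)
  hence "(\<lambda>n. \<Sum>j\<in>I. q j * (L n * c j (Suc n) * z ^ n)) sums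
      remove_sings (tremblay_quotient \<tau> \<mu> \<delta> (\<lambda>z. \<Sum>j\<in>I. q j * f j z)) z"
    by (simp add: sum_distrib_left sum_distrib_right mult_ac)
  ultimately show ?thesis by (rule sums_unique2[symmetric])
qed

theorem theorem7:
  fixes k p :: nat and \<tau> \<mu> \<delta> \<gamma> :: real
    and f :: "nat \<Rightarrow> complex \<Rightarrow> complex" and q :: "nat \<Rightarrow> real"
  assumes "k \<ge> 1" and "p \<ge> 1"
    and "0 < \<tau>" and "\<tau> \<le> 1" and "0 < \<mu>" and "\<mu> \<le> 1"
    and "0 \<le> \<tau> - \<mu>" and "\<tau> - \<mu> < 1"
    and "0 \<le> \<delta>" and "\<delta> < 1" and "0 \<le> \<gamma>" and "\<gamma> < 1"
    and "\<tau> - \<mu> + \<gamma> < 1"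
    and "\<And>j. j \<in> {1..p} \<Longrightarrow> f j \<in> tremblay_class \<tau> \<mu> k \<delta> \<gamma>"
    and "\<And>j. j \<in> {1..p} \<Longrightarrow> q j \<ge> 0"
    and "(\<Sum>j=1..p. q j) = 1"
  shows "(\<lambda>z. \<Sum>j=1..p. of_real (q j) * f j z) \<in> tremblay_class \<tau> \<mu> k \<delta> \<gamma>"
proof -
  have f: "f j \<in> neg_coeff_univalent k"
    "\<And>z. z \<in> unit_disc \<Longrightarrow> \<gamma> < Re (remove_sings (tremblay_quotient \<tau> \<mu> \<delta> (f j)) z)"
    if "j \<in> {1..p}" for j
    using assms(14)[OF that] by (auto simp: tremblay_class_def)
  have f_0: "f j 0 = 0" if j: "j \<in> {1..p}" for j
  proof -
    obtain a :: "nat \<Rightarrow> real" where "\<And>n. n \<le> k \<Longrightarrow> a n = 0"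
      "\<And>z. z \<in> unit_disc \<Longrightarrow> (\<lambda>n. of_real (a n) * z ^ n) sums (z - f j z)"
      using neg_coeff_univalentE[OF f(1)[OF j]] by metis
    from this(1)[of 0] this(2)[of 0] show ?thesis by simp
  qed
  have f_analytic: "f j analytic_on unit_disc" if "j \<in> {1..p}" for j
    using f(1)[OF that] by (simp add: neg_coeff_univalent_def)
  have "\<gamma> < Re (remove_sings (tremblay_quotient \<tau> \<mu> \<delta> (\<lambda>z. \<Sum>j=1..p. of_real (q j) * f j z)) z)"
    if z: "z \<in> unit_disc" for z
  proof -
    let ?R = "\<lambda>j. Re (remove_sings (tremblay_quotient \<tau> \<mu> \<delta> (f j)) z)"
    \<comment> \<open>Negation turns the lower bound on the real parts into the upper bound that the
      averaging lemma handles.\<close>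
    have "(\<Sum>j=1..p. q j * (- ?R j)) < - \<gamma>"
      using assms(15,16) f(2)[OF _ z] by (intro convex_sum_bound_less) auto
    moreover have "Re (remove_sings (tremblay_quotient \<tau> \<mu> \<delta> (\<lambda>z. \<Sum>j=1..p. of_real (q j) * f j z)) z) =
        (\<Sum>j=1..p. q j * ?R j)"
      using assms(3,8) f_analytic f_0 z by (subst remove_sings_tremblay_quotient_sum) auto
    ultimately show ?thesis by (simp add: sum_negf)
  qed
  moreover have "(\<lambda>z. \<Sum>j=1..p. of_real (q j) * f j z) \<in> neg_coeff_univalent k"
    by (rule neg_coeff_univalent_convex_combination) (use assms(1,15,16) f(1) in auto)
  ultimately show ?thesis by (simp add: tremblay_class_def)
qed

end
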